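(* Let $\varepsilon\in\{\pm1\}$ and let $\gamma:\mathbb{R}\to\mathbf{P}^1(\mathbb{C})\setminus\{1,\omega,\omega^2\}$ be a non-constant continuous map such that $\gamma(0)\notin\{0,\infty\}$ and $\gamma(t+\frac13)=\omega^{\varepsilon}\gamma(t)$ for all $t\in\mathbb{R}$. Set $\xi(t):=\gamma(t)/\gamma(0)$. (i) There exists a collision-free single tracing orbit $\{\Delta(t)\}_t$ with $\psi(\Delta(t))=\gamma(t)$ for all $t$, in ascending order when $\varepsilon=1$ (resp. in descending order when $\varepsilon=-1$), if and only if $\xi(t)$ can be written in the form $$\xi(t)=\frac{\eta_2(t)}{\eta_1(t)}$$ with continuous functions $\eta_r:\mathbb{R}\to\mathbb{C}$ satisfying $\eta_r(t+\frac13)=\omega^{\varepsilon r}\eta_r(t)$ for all $t$ $(r=1,2)$. (ii) In particular, if $\gamma(t)\neq\infty$ for all $t$, then the condition in (i) is satisfied with $\eta_2(t)=e^{2\pi i\varepsilon t}\xi(t)$ and $\eta_1(t)=e^{2\pi i\varepsilon t}$. (iii) Suppose that the condition in (i) is satisfied, with functions $\eta_1,\eta_2$ as there. Then every possible tracing orbit $\{\Delta(t)\}_t$ with $\psi(\Delta(t))=\gamma(t)$ for all $t$ is obtained as $$\Delta(t)=W \begin{pmatrix} 1 & 0 & 0 \\ 0 & \eta_1(t)\mu(t) & 0 \\ 0 & 0 & \eta_2(t)\mu(t) \end{pmatrix} W^{-1} \begin{pmatrix} a_0 \\ b_0 \\ c_0 \end{pmatrix},$$ where $\mu:\mathbb{R}\to\mathbb{C}^\times$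 is a continuous function with period $\frac13$ and $\Delta_0=(a_0,b_0,c_0)$ is a triangle triple with $\psi(\Delta_0)=\gamma(0)$.
   Context: Let $\omega=e^{2\pi i/3}$ and $\mathbf{P}^1(\mathbb{C})=\mathbb{C}\cup\{\infty\}$. A triangle triple is a vector $\Delta=(a,b,c)\in\mathbb{C}^3$, viewed as a column vector. Put $$J=\begin{pmatrix} 0 & 1 & 0 \\ 0 & 0 & 1 \\ 1 & 0 & 0 \end{pmatrix},\quad W=\begin{pmatrix} 1 & 1 & 1 \\ 1 & \omega & \omega^2 \\ 1 & \omega^2 & \omega \end{pmatrix}.$$ For $\Delta=(a,b,c)$ put $\psi_1(\Delta)=\frac13(a+b\omega^2+c\omega)$, $\psi_2(\Delta)=\frac13(a+b\omega+c\omega^2)$. For $\Delta\in\mathbb{C}^3\setminus\{(a,a,a)\mid a\in\mathbb{C}\}$ the shape function is $\psi(\Delta)=\psi_2(\Delta)/\psi_1(\Delta)\in\mathbf{P}^1(\mathbb{C})$. Throughout, the convention $1/0=\infty$ is used, so that a quotient $u/v$ is a point of $\mathbf{P}^1(\mathbb{C})$ for $(u,v)\neq(0,0)$; writing $\xi(t)=\eta_2(t)/\eta_1(t)$ presupposes $(\eta_1(t),\eta_2(t))\neq(0,0)$ for all $t$. For $\eta,\eta'\in\mathbb{C}$ put $\mathcal{S}[\eta,\eta']:=W\,\mathrm{diag}(1,\eta',\eta)\,W^{-1}$, acting on $\mathbb{C}^3$. The families considered are periodic maps $\mathbb{R}\to\mathbb{R}/\mathbb{Z}\to\mathbb{C}^3\setminus\{(a,a,a)\mid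 a\in\mathbb{C}\}$ of the form $\Delta(t)=\mathcal{S}[\eta(t),\eta'(t)](\Delta)$ with $\Delta\in\mathbb{C}^3\setminus\{(a,a,a)\mid a\in\mathbb{C}\}$ and $\eta,\eta':\mathbb{R}\to\mathbb{C}$ continuous of period $1$ (so the centroid of $\Delta(t)$ is constant in $t$). Such a family has a single tracing orbit (is a single tracing orbit) in ascending (resp. descending) order if $J\,\Delta(t)=\Delta(t+\frac13)$ (resp. $J\,\Delta(t)=\Delta(t-\frac13)$) for all $t$. It is collision-free if, for every $t$, the three components of $\Delta(t)$ are pairwise distinct. In (iii), the tracing orbits are in ascending order when $\varepsilon=1$ and in descending order when $\varepsilon=-1$. *)

theory Defs
  imports "HOL-Analysis.Analysis"
begin

definition omega :: complex where
  "omega = exp (2 * of_real pi * \<i> / 3)"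

text \<open>The complex projective line \<open>\<complex> \<union> {\<infinity>}\<close> is represented by \<^typ>\<open>complex option\<close>, with
  \<^const>\<open>None\<close> as the point at infinity; its topology is that of the one-point
  compactification of the plane.\<close>

type_synonym P1 = "complex option"

abbreviation P1_infty :: P1 where
  "P1_infty \<equiv> None"

abbreviation P1_of :: "complex \<Rightarrow> P1" where
  "P1_of z \<equiv> Some z"

definition P1_topology :: "P1 topology" where
  "P1_topology = Alexandroff_compactification euclidean"

text \<open>The value of \<open>P1_quot u v\<close> for \<open>(u, v) = (0, 0)\<close> is meaningless; every use below comes with
  the requirement that the pair does not vanish.\<close>

definition P1_quot :: "complex \<Rightarrow> complex \<Rightarrow> P1" where
  "P1_quot u v = (if v = 0 then P1_infty else P1_of (u / v))"

text \<open>Multiplication by a scalar \<open>c \<noteq> 0\<close>, so that \<open>\<infinity>\<close> is fixed.\<close>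

definition P1_scale :: "complex \<Rightarrow> P1 \<Rightarrow> P1" where
  "P1_scale c = map_option (\<lambda>z. c * z)"

definition J_mat :: "complex^3^3" where
  "J_mat = vector [vector [0, 1, 0], vector [0, 0, 1], vector [1, 0, 0]]"

definition W_mat :: "complex^3^3" where
  "W_mat = vector [vector [1, 1, 1], vector [1, omega, omega\<^sup>2], vector [1, omega\<^sup>2, omega]]"

definition diag3 :: "complex \<Rightarrow> complex \<Rightarrow> complex \<Rightarrow> complex^3^3" where
  "diag3 x y z = vector [vector [x, 0, 0], vector [0, y, 0], vector [0, 0, z]]"

definition nondegenerate :: "(complex^3) set" where
  "nondegenerate = UNIV - {vector [a, a, a] | a. True}"

definition psi1 :: "complex^3 \<Rightarrow> complex" where
  "psi1 D = (D$1 + D$2 * omega\<^sup>2 + D$3 * omega) / 3"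

definition psi2 :: "complex^3 \<Rightarrow> complex" where
  "psi2 D = (D$1 + D$2 * omega + D$3 * omega\<^sup>2) / 3"

text \<open>The shape function; meaningful on \<open>nondegenerate\<close>, where \<open>(psi1 D, psi2 D) \<noteq> (0, 0)\<close>.\<close>

definition psi :: "complex^3 \<Rightarrow> P1" where
  "psi D = P1_quot (psi2 D) (psi1 D)"

definition S_op :: "complex \<Rightarrow> complex \<Rightarrow> complex^3^3" where
  "S_op \<eta> \<eta>' = W_mat ** diag3 1 \<eta>' \<eta> ** matrix_inv W_mat"

definition triangle_family :: "(real \<Rightarrow> complex^3) \<Rightarrow> bool" where
  "triangle_family D \<longleftrightarrow>
     (\<forall>t. D t \<in> nondegenerate) \<and>
     (\<exists>D0 \<in> nondegenerate. \<exists>\<eta> \<eta>'.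
        continuous_on UNIV \<eta> \<and> continuous_on UNIV \<eta>' \<and>
        (\<forall>t. \<eta> (t + 1) = \<eta> t) \<and> (\<forall>t. \<eta>' (t + 1) = \<eta>' t) \<and>
        (\<forall>t. D t = S_op (\<eta> t) (\<eta>' t) *v D0))"

text \<open>The order is ascending for \<open>\<epsilon> = 1\<close> and descending for \<open>\<epsilon> = -1\<close>.\<close>

definition single_tracing_orbit :: "int \<Rightarrow> (real \<Rightarrow> complex^3) \<Rightarrow> bool" where
  "single_tracing_orbit \<epsilon> D \<longleftrightarrow>
     triangle_family D \<and> (\<forall>t. J_mat *v D t = D (t + of_int \<epsilon> / 3))"

definition collision_free :: "(real \<Rightarrow> complex^3) \<Rightarrow> bool" where
  "collision_free D \<longleftrightarrow> (\<forall>t i j. i \<noteq> j \<longrightarrow> D t $ i \<noteq> D t $ j)"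

definition equivariant_quotient ::
    "int \<Rightarrow> (real \<Rightarrow> P1) \<Rightarrow> (real \<Rightarrow> complex) \<Rightarrow> (real \<Rightarrow> complex) \<Rightarrow> bool" where
  "equivariant_quotient \<epsilon> \<xi> \<eta>1 \<eta>2 \<longleftrightarrow>
     continuous_on UNIV \<eta>1 \<and> continuous_on UNIV \<eta>2 \<and>
     (\<forall>t. \<eta>1 (t + 1/3) = omega powi \<epsilon> * \<eta>1 t) \<and>
     (\<forall>t. \<eta>2 (t + 1/3) = omega powi (\<epsilon> * 2) * \<eta>2 t) \<and>
     (\<forall>t. (\<eta>1 t, \<eta>2 t) \<noteq> (0, 0) \<and> \<xi> t = P1_quot (\<eta>2 t) (\<eta>1 t))"

end

theory Submission imports Defs begin

text \<open>The columns of \<open>W_mat\<close> are a common eigenbasis of \<open>J_mat\<close> and of all \<open>S_op \<eta> \<eta>'\<close>, and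
  \<open>psi0\<close>, \<open>psi1\<close>, \<open>psi2\<close> are the coordinates in this basis. In these coordinates \<open>S_op \<eta> \<eta>'\<close> keeps
  \<open>psi0\<close> and multiplies \<open>psi1\<close>, \<open>psi2\<close> by \<open>\<eta>'\<close>, \<open>\<eta>\<close>, while \<open>J_mat\<close> multiplies them by
  \<open>\<omega>\<close>, \<open>\<omega>\<^sup>2\<close>. A tracing orbit of shape \<open>\<gamma>\<close> is therefore the same as a constant together with a lift
  of \<open>\<gamma>\<close> to an equivariant pair \<open>(psi1, psi2)\<close>, and two lifts differ by a scalar function \<open>\<mu>\<close>.\<close>

definition psi0 :: "complex^3 \<Rightarrow> complex" where
  "psi0 D = (D$1 + D$2 + D$3) / 3"

section \<open>Arithmetic of the primitive cube root of unity\<close>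

lemma omega_cubed: "omega ^ 3 = 1"
proof -
  have "omega ^ 3 = exp (of_nat 3 * (2 * of_real pi * \<i> / 3))"
    unfolding omega_def by (rule exp_of_nat_mult[symmetric])
  also have "\<dots> = 1"
    by (simp add: mult_ac)
  finally show ?thesis .
qed

lemma omega_neq_0 [simp]: "omega \<noteq> 0"
  by (simp add: omega_def)

lemma omega_neq_1: "omega \<noteq> 1"
proof
  assume "omega = 1"
  then have "Re omega = 1" by simp
  then have "cos (2 * pi / 3) = 1"
    by (simp add: omega_def Re_exp)
  then show False by (simp add: cos_120)
qed

lemma omega_power2: "omega\<^sup>2 = - 1 - omega"
proof -
  have "(omega - 1) * (omega\<^sup>2 + omega + 1) = 0"
    using omega_cubed by (simp add: algebra_simps power2_eq_square power3_eq_cube)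
  then have "omega\<^sup>2 + omega + 1 = 0"
    using omega_neq_1 by simp
  then show ?thesis by (simp add: algebra_simps eq_neg_iff_add_eq_0)
qed

lemma omega_mult_omega: "omega * omega = - 1 - omega"
  using omega_power2 by (simp add: power2_eq_square)

text \<open>Products nested to the right hide the factor \<open>omega * omega\<close> from the
  simplifier. With this variant, expressions polynomial in \<open>omega\<close> reduce to degree at
  most one.\<close>

lemma omega_mult_omega_left: "omega * (omega * x) = - x - omega * x"
  using omega_mult_omega by (metis (no_types) left_diff_distrib mult.assoc mult_minus_left mult_1)

lemmas omega_simps = omega_power2 omega_mult_omega omega_mult_omega_left

lemma inverse_omega: "inverse omega = omega\<^sup>2"
  using omega_cubed by (intro inverse_unique) (simp add: power2_eq_square power3_eq_cube mult.assoc)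

text \<open>Gives the model function with multiplier \<open>omega powi n\<close> under the shift by
  1/3; it has no zeros and so can serve as a denominator.\<close>

lemma exp_third_eq_omega_powi:
  "exp (2 * of_real pi * \<i> * of_int n * of_real (t + 1/3))
     = omega powi n * exp (2 * of_real pi * \<i> * of_int n * of_real t)"
proof -
  have "omega powi n = exp (of_int n * (2 * of_real pi * \<i> / 3))"
    unfolding omega_def by (simp add: exp_power_int mult.commute)
  then show ?thesis
    by (simp add: exp_add[symmetric] algebra_simps)
qed

section \<open>Diagonalisation by \<open>W_mat\<close>\<close>

definition W_inv :: "complex^3^3" where
  "W_inv = vector [vector [1/3, 1/3, 1/3], vector [1/3, omega\<^sup>2/3, omega/3],
                   vector [1/3, omega/3, omega\<^sup>2/3]]"

text \<open>\<open>W_mat\<close> is the Fourier matrix of order 3, so its inverse is a third of its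
  complex conjugate. The rows of \<open>W_inv\<close> are the coefficients of \<open>psi0\<close>,
  \<open>psi1\<close>, \<open>psi2\<close>.\<close>

lemma W_mult_W_inv: "W_mat ** W_inv = mat 1"
  by (simp add: vec_eq_iff forall_3 matrix_matrix_mult_def sum_3 W_mat_def W_inv_def mat_def
      omega_simps field_simps)

text \<open>\<open>matrix_inv\<close> is a choice among two-sided inverses. One exists because a
  right inverse of a square matrix is also a left inverse, and it is unique.\<close>

lemma matrix_inv_W: "matrix_inv W_mat = W_inv"
proof -
  have "matrix_inv W_mat ** W_mat = mat 1"
    using W_mult_W_inv matrix_left_right_inverse[of W_mat W_inv]
    unfolding matrix_inv_def by (metis (mono_tags, lifting) someI)
  then show ?thesis
    using W_mult_W_inv by (metis matrix_mul_assoc matrix_mul_lid matrix_mul_rid)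
qed

lemma W_inv_mult_vector: "W_inv *v D = vector [psi0 D, psi1 D, psi2 D]"
  by (simp add: vec_eq_iff forall_3 matrix_vector_mult_def sum_3 W_inv_def
      psi0_def psi1_def psi2_def field_simps)

lemma psi_W_mult_vector [simp]:
  "psi0 (W_mat *v vector [x, y, z]) = x"
  "psi1 (W_mat *v vector [x, y, z]) = y"
  "psi2 (W_mat *v vector [x, y, z]) = z"
  by (simp_all add: psi0_def psi1_def psi2_def matrix_vector_mult_def sum_3 W_mat_def
      omega_simps algebra_simps)

lemma W_mult_vector_psi: "W_mat *v vector [psi0 D, psi1 D, psi2 D] = D"
  by (metis W_inv_mult_vector W_mult_W_inv matrix_vector_mul_assoc matrix_vector_mul_lid)

lemma eq_iff_psi_eq: "D = E \<longleftrightarrow> psi0 D = psi0 E \<and> psi1 D = psi1 E \<and> psi2 D = psi2 E"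
  by (metis W_mult_vector_psi)

lemma psi_S_op [simp]:
  "psi0 (S_op \<eta> \<eta>' *v D) = psi0 D"
  "psi1 (S_op \<eta> \<eta>' *v D) = \<eta>' * psi1 D"
  "psi2 (S_op \<eta> \<eta>' *v D) = \<eta> * psi2 D"
proof -
  have "diag3 1 \<eta>' \<eta> *v vector [x, y, z] = vector [x, \<eta>' * y, \<eta> * z]" for x y z
    by (simp add: vec_eq_iff forall_3 matrix_vector_mult_def sum_3 diag3_def)
  then have "S_op \<eta> \<eta>' *v D = W_mat *v vector [psi0 D, \<eta>' * psi1 D, \<eta> * psi2 D]"
    by (simp add: S_op_def matrix_inv_W W_inv_mult_vector flip: matrix_vector_mul_assoc)
  then show "psi0 (S_op \<eta> \<eta>' *v D) = psi0 D" "psi1 (S_op \<eta> \<eta>' *v D) = \<eta>' * psi1 D"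
    "psi2 (S_op \<eta> \<eta>' *v D) = \<eta> * psi2 D"
    by simp_all
qed

lemma psi_J_mat [simp]:
  "psi0 (J_mat *v D) = psi0 D"
  "psi1 (J_mat *v D) = omega * psi1 D"
  "psi2 (J_mat *v D) = omega\<^sup>2 * psi2 D"
  by (simp_all add: psi0_def psi1_def psi2_def matrix_vector_mult_def sum_3 J_mat_def
      omega_simps field_simps)

text \<open>The constant triples are the multiples of the first column of
  \<open>W_mat\<close>.\<close>

lemma nondegenerate_iff: "D \<in> nondegenerate \<longleftrightarrow> (psi1 D, psi2 D) \<noteq> (0, 0)"
proof -
  have "vector [a, a, a] = W_mat *v vector [a, 0, 0]" for a :: complex
    by (simp add: vec_eq_iff forall_3 matrix_vector_mult_def sum_3 W_mat_def)
  then have "D = vector [a, a, a] \<longleftrightarrow> psi0 D = a \<and> psi1 D = 0 \<and> psi2 D = 0" for a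
    by (simp add: eq_iff_psi_eq)
  then show ?thesis
    by (auto simp: nondegenerate_def)
qed

section \<open>Points of the projective line\<close>

lemma P1_quot_eq_iff:
  assumes "(u, v) \<noteq> (0, 0)" "(u', v') \<noteq> (0, 0)"
  shows "P1_quot u v = P1_quot u' v' \<longleftrightarrow> u * v' = u' * v"
  using assms by (auto simp: P1_quot_def field_simps)

lemma P1_scale_eq_iff:
  assumes "c \<noteq> 0"
  shows "x = P1_scale (1 / c) y \<longleftrightarrow> P1_scale c x = y"
  using assms by (cases x; cases y) (auto simp: P1_scale_def field_simps)

text \<open>\<open>Some\<close> is an open map into the one-point compactification, so open sets of
  the plane have open preimages under a continuous map that avoids infinity.\<close>

lemma continuous_on_the_P1:
  assumes "continuous_map euclideanreal P1_topology \<gamma>" "\<And>t. \<gamma> t \<noteq> P1_infty"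
  shows "continuous_on UNIV (\<lambda>t. the (\<gamma> t))"
  unfolding continuous_on_open_vimage[OF open_UNIV]
proof (intro allI impI)
  fix U :: "complex set"
  assume "open U"
  then have "openin P1_topology (Some ` U)"
    unfolding P1_topology_def by (simp add: openin_Alexandroff_compactification_image_Some)
  then have "open {t. \<gamma> t \<in> Some ` U}"
    using openin_continuous_map_preimage[OF assms(1)] by auto
  moreover have "{t. \<gamma> t \<in> Some ` U} = (\<lambda>t. the (\<gamma> t)) -` U \<inter> UNIV"
    using assms(2) by (force simp: image_iff)
  ultimately show "open ((\<lambda>t. the (\<gamma> t)) -` U \<inter> UNIV)" by simp
qed

section \<open>Collisions and excluded shapes\<close>

lemma collision_free_iff:
  "collision_free D \<longleftrightarrow> (\<forall>t. D t $ 1 \<noteq> D t $ 2 \<and> D t $ 1 \<noteq> D t $ 3 \<and> D t $ 2 \<noteq> D t $ 3)"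
  by (simp add: collision_free_def forall_3) metis

text \<open>Two vertices meet exactly when \<open>psi1 D = z * psi2 D\<close> for the corresponding
  cube root of unity z, the prefactors being nonzero. For a nondegenerate triple this means shape
  1/z, whence the three excluded values.\<close>

lemma component_differences:
  "D$1 - D$2 = (1 - omega) * (psi1 D - omega\<^sup>2 * psi2 D)"
  "D$1 - D$3 = (1 - omega\<^sup>2) * (psi1 D - omega * psi2 D)"
  "D$2 - D$3 = (omega - omega\<^sup>2) * (psi1 D - psi2 D)"
  by (simp_all add: psi1_def psi2_def omega_simps field_simps)

lemma collision_free_if_shape:
  assumes "\<And>t. D t \<in> nondegenerate"
    and "\<And>t. psi (D t) \<notin> {P1_of 1, P1_of omega, P1_of (omega\<^sup>2)}"
  shows "collision_free D"
proof -
  have one: "psi1 (D t) \<noteq> z * psi2 (D t)" if "z \<in> {1, omega, omega\<^sup>2}" for t z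
  proof
    assume eq: "psi1 (D t) = z * psi2 (D t)"
    have "psi2 (D t) \<noteq> 0"
      using eq assms(1)[of t] by (auto simp: nondegenerate_iff)
    moreover have "z \<noteq> 0" using that by auto
    ultimately have "psi (D t) = P1_of (inverse z)"
      by (simp add: psi_def P1_quot_def eq field_simps)
    moreover have "inverse (omega\<^sup>2) = omega"
      using inverse_omega by (metis inverse_inverse_eq)
    ultimately show False
      using assms(2)[of t] that by (auto simp: inverse_omega)
  qed
  have "omega\<^sup>2 \<noteq> 1" "omega \<noteq> omega\<^sup>2"
    using inverse_omega omega_neq_1 by (metis inverse_1 inverse_inverse_eq,
      metis power2_eq_square mult_cancel_left1 omega_neq_0)
  then show ?thesis
    using one[of 1] one[of omega] one[of "omega\<^sup>2"] omega_neq_1 component_differences[of "D _"]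
    unfolding collision_free_iff
    by (metis diff_self eq_iff_diff_eq_0 insertCI mult_1 mult_eq_0_iff)
qed

section \<open>Tracing orbits as equivariant lifts\<close>

lemma J_shift_iff:
  fixes D :: "real \<Rightarrow> complex^3"
  assumes "\<epsilon> \<in> {1, -1 :: int}"
  shows "(\<forall>t. J_mat *v D t = D (t + of_int \<epsilon> / 3)) \<longleftrightarrow>
    (\<forall>t. psi0 (D (t + 1/3)) = psi0 (D t) \<and>
         psi1 (D (t + 1/3)) = omega powi \<epsilon> * psi1 (D t) \<and>
         psi2 (D (t + 1/3)) = omega powi (\<epsilon> * 2) * psi2 (D t))"
proof (cases "\<epsilon> = 1")
  case True
  then show ?thesis by (auto simp: eq_iff_psi_eq[of "J_mat *v _"])
next
  case False
  with assms have eps: "\<epsilon> = -1" by simp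
  \<comment> \<open>Reparametrising turns the backward shift into a forward one, so the eigenvalues
    of \<open>J_mat\<close> enter inverted. This produces the sign of \<epsilon> in the
    exponents.\<close>
  have "(\<forall>t. J_mat *v D t = D (t - 1/3)) \<longleftrightarrow> (\<forall>t. J_mat *v D (t + 1/3) = D t)"
  proof (intro iffI allI)
    fix t
    show "J_mat *v D (t + 1/3) = D t" if "\<forall>t. J_mat *v D t = D (t - 1/3)"
      using spec[OF that, of "t + 1/3"] by simp
    show "J_mat *v D t = D (t - 1/3)" if "\<forall>t. J_mat *v D (t + 1/3) = D t"
      using spec[OF that, of "t - 1/3"] by simp
  qed
  moreover have "omega * x = y \<longleftrightarrow> x = omega powi (-1) * y"
    "omega\<^sup>2 * x = y \<longleftrightarrow> x = omega powi (-2) * y" for x y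
    by (auto simp: power_int_minus field_simps)
  ultimately show ?thesis
    by (simp add: eps eq_iff_psi_eq[of "J_mat *v _"])
qed

lemma omega_powi_mult_3: "omega powi (n * 3) = 1"
  using power_int_mult[of omega 3 n] omega_cubed by (simp add: mult.commute)

text \<open>Supplies the period 1 that \<open>triangle_family\<close> demands: three shifts by 1/3
  multiply by the cube of a cube root of unity.\<close>

lemma period_one_if_third:
  assumes "\<And>t. f (t + 1/3 :: real) = omega powi n * f t"
  shows "f (t + 1) = f t"
proof -
  have "f (t + 1) = f (((t + 1/3) + 1/3) + 1/3)" by (simp add: add.commute)
  also have "\<dots> = (omega powi n) ^ 3 * f t"
    by (simp only: assms) (simp add: power3_eq_cube)
  also have "(omega powi n) ^ 3 = 1"
    using omega_powi_mult_3[of n] by (metis power_int_mult power_int_numeral)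
  finally show ?thesis by simp
qed

lemma triangle_familyD:
  assumes "triangle_family D"
  shows "D t \<in> nondegenerate" "psi0 (D t) = psi0 (D s)"
    "continuous_on UNIV (\<lambda>t. psi1 (D t))" "continuous_on UNIV (\<lambda>t. psi2 (D t))"
  using assms unfolding triangle_family_def by (auto intro!: continuous_intros)

lemma psi_nonzero_if:
  assumes "psi D \<notin> {P1_of 0, P1_infty}"
  shows "psi1 D \<noteq> 0" "psi2 D \<noteq> 0"
  using assms by (auto simp: psi_def P1_quot_def split: if_splits)

text \<open>Dividing the shape by its value at 0 amounts to dividing each coordinate by its value at
  0. Both values are nonzero, since the shape at 0 is neither 0 nor infinity.\<close>

lemma equivariant_quotient_of_orbit:
  assumes eps: "\<epsilon> \<in> {1, -1 :: int}" and orbit: "single_tracing_orbit \<epsilon> D"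
    and base: "psi (D 0) \<notin> {P1_of 0, P1_infty}"
  shows "equivariant_quotient \<epsilon> (\<lambda>t. P1_scale (1 / the (psi (D 0))) (psi (D t)))
    (\<lambda>t. psi1 (D t) / psi1 (D 0)) (\<lambda>t. psi2 (D t) / psi2 (D 0))"
proof -
  have fam: "triangle_family D"
    using orbit by (simp add: single_tracing_orbit_def)
  have shift: "psi1 (D (t + 1/3)) = omega powi \<epsilon> * psi1 (D t)"
    "psi2 (D (t + 1/3)) = omega powi (\<epsilon> * 2) * psi2 (D t)" for t
    using orbit J_shift_iff[OF eps] by (auto simp: single_tracing_orbit_def)
  note nz = psi_nonzero_if[OF base]
  have "P1_scale (1 / the (psi (D 0))) (psi (D t))
      = P1_quot (psi2 (D t) / psi2 (D 0)) (psi1 (D t) / psi1 (D 0))" for t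
    using nz by (auto simp: psi_def P1_quot_def P1_scale_def field_simps)
  then show ?thesis
    using triangle_familyD[OF fam] nz
    by (auto simp: equivariant_quotient_def shift nondegenerate_iff intro!: continuous_intros)
qed

text \<open>\<open>S_op\<close> takes the multiplier of \<open>psi2\<close> first, hence the order
  of its arguments. Both coordinates of \<open>D0\<close> are nonzero, so the pair of products
  vanishes nowhere.\<close>

lemma orbit_of_equivariant_quotient:
  assumes eps: "\<epsilon> \<in> {1, -1 :: int}" and eq: "equivariant_quotient \<epsilon> \<xi> \<eta>1 \<eta>2"
    and base: "psi D0 \<notin> {P1_of 0, P1_infty}"
  shows "single_tracing_orbit \<epsilon> (\<lambda>t. S_op (\<eta>2 t) (\<eta>1 t) *v D0)"
    and "psi (S_op (\<eta>2 t) (\<eta>1 t) *v D0) = P1_scale (the (psi D0)) (\<xi> t)"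
proof -
  note nz = psi_nonzero_if[OF base]
  have \<eta>: "continuous_on UNIV \<eta>1" "continuous_on UNIV \<eta>2"
    "\<And>t. \<eta>1 (t + 1/3) = omega powi \<epsilon> * \<eta>1 t"
    "\<And>t. \<eta>2 (t + 1/3) = omega powi (\<epsilon> * 2) * \<eta>2 t"
    "\<And>t. (\<eta>1 t, \<eta>2 t) \<noteq> (0, 0)" "\<And>t. \<xi> t = P1_quot (\<eta>2 t) (\<eta>1 t)"
    using eq unfolding equivariant_quotient_def by blast+
  have D0: "D0 \<in> nondegenerate"
    using nz by (simp add: nondegenerate_iff)
  have nondeg: "S_op (\<eta>2 t) (\<eta>1 t) *v D0 \<in> nondegenerate" for t
    using \<eta>(5)[of t] nz by (auto simp: nondegenerate_iff)
  have "triangle_family (\<lambda>t. S_op (\<eta>2 t) (\<eta>1 t) *v D0)"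
    unfolding triangle_family_def
    using nondeg D0 \<eta>(1,2) period_one_if_third[of \<eta>1, OF \<eta>(3)] period_one_if_third[of \<eta>2, OF \<eta>(4)]
    by blast
  moreover have "\<forall>t. J_mat *v (S_op (\<eta>2 t) (\<eta>1 t) *v D0)
      = S_op (\<eta>2 (t + of_int \<epsilon> / 3)) (\<eta>1 (t + of_int \<epsilon> / 3)) *v D0"
    by (subst J_shift_iff[OF eps]) (simp add: \<eta>(3,4))
  ultimately show "single_tracing_orbit \<epsilon> (\<lambda>t. S_op (\<eta>2 t) (\<eta>1 t) *v D0)"
    unfolding single_tracing_orbit_def by blast
  show "psi (S_op (\<eta>2 t) (\<eta>1 t) *v D0) = P1_scale (the (psi D0)) (\<xi> t)"
    using nz by (simp add: \<eta>(6) psi_def P1_quot_def P1_scale_def)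
qed

section \<open>Rescaling a lift and comparing two lifts\<close>

lemma equivariant_quotient_scale:
  assumes "equivariant_quotient \<epsilon> \<xi> \<eta>1 \<eta>2"
    and "continuous_on UNIV \<mu>" "\<And>t. \<mu> t \<noteq> 0" "\<And>t. \<mu> (t + 1/3) = \<mu> t"
  shows "equivariant_quotient \<epsilon> \<xi> (\<lambda>t. \<eta>1 t * \<mu> t) (\<lambda>t. \<eta>2 t * \<mu> t)"
  using assms unfolding equivariant_quotient_def
  by (auto simp: P1_quot_def intro!: continuous_intros)

text \<open>Two lifts of the same map differ by \<open>\<mu> = \<langle>\<theta>, \<eta>\<rangle> / \<langle>\<eta>, \<eta>\<rangle>\<close>; the Hermitian product makes
  continuity visible also where \<open>\<eta>1\<close> or \<open>\<eta>2\<close> vanishes.\<close>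

lemma equivariant_quotient_unique:
  assumes \<eta>: "equivariant_quotient \<epsilon> \<xi> \<eta>1 \<eta>2" and \<theta>: "equivariant_quotient \<epsilon> \<xi> \<theta>1 \<theta>2"
  obtains \<mu> where "continuous_on UNIV \<mu>" "\<And>t. \<mu> t \<noteq> 0" "\<And>t. \<mu> (t + 1/3) = \<mu> t"
    "\<And>t. \<theta>1 t = \<eta>1 t * \<mu> t" "\<And>t. \<theta>2 t = \<eta>2 t * \<mu> t"
proof
  define N where "N t = \<eta>1 t * cnj (\<eta>1 t) + \<eta>2 t * cnj (\<eta>2 t)" for t
  define \<mu> where "\<mu> t = (\<theta>1 t * cnj (\<eta>1 t) + \<theta>2 t * cnj (\<eta>2 t)) / N t" for t
  have \<eta>_nz: "\<eta>1 t \<noteq> 0 \<or> \<eta>2 t \<noteq> 0" and \<theta>_nz: "\<theta>1 t \<noteq> 0 \<or> \<theta>2 t \<noteq> 0" for t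
    using \<eta> \<theta> by (auto simp: equivariant_quotient_def)
  have "N t = of_real ((cmod (\<eta>1 t))\<^sup>2 + (cmod (\<eta>2 t))\<^sup>2)" for t
    by (simp add: N_def complex_norm_square[symmetric] del: of_real_power flip: of_real_power)
  then have N_nz: "N t \<noteq> 0" for t
    using \<eta>_nz[of t] by (simp only: of_real_eq_0_iff) (simp add: sum_power2_eq_zero_iff)
  have "continuous_on UNIV N"
    using \<eta> unfolding N_def equivariant_quotient_def by (auto intro!: continuous_intros)
  then show "continuous_on UNIV \<mu>"
    using \<eta> \<theta> N_nz unfolding \<mu>_def equivariant_quotient_def by (auto intro!: continuous_intros)
  have "P1_quot (\<eta>2 t) (\<eta>1 t) = P1_quot (\<theta>2 t) (\<theta>1 t)" for t
    using \<eta> \<theta> by (metis equivariant_quotient_def)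
  then have cross: "\<eta>2 t * \<theta>1 t = \<theta>2 t * \<eta>1 t" for t
    using P1_quot_eq_iff \<eta>_nz[of t] \<theta>_nz[of t] by blast
  \<comment> \<open>In each identity the two sides differ by a conjugate,
    \<open>cnj (\<eta>2 t)\<close> or \<open>cnj (\<eta>1 t)\<close>, times the difference of the
    sides of \<open>cross\<close>, up to sign.\<close>
  have "\<theta>1 t * N t = \<eta>1 t * (\<theta>1 t * cnj (\<eta>1 t) + \<theta>2 t * cnj (\<eta>2 t))"
    "\<theta>2 t * N t = \<eta>2 t * (\<theta>1 t * cnj (\<eta>1 t) + \<theta>2 t * cnj (\<eta>2 t))" for t
    using cross[of t] unfolding N_def by algebra+
  then show \<theta>1: "\<theta>1 t = \<eta>1 t * \<mu> t" and \<theta>2: "\<theta>2 t = \<eta>2 t * \<mu> t" for t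
    using N_nz[of t] by (simp_all add: \<mu>_def field_simps)
  show "\<mu> t \<noteq> 0" for t
    using \<theta>_nz[of t] \<theta>1[of t] \<theta>2[of t] by auto
  show "\<mu> (t + 1/3) = \<mu> t" for t
  proof -
    \<comment> \<open>Both lifts carry the same multipliers. These cancel, and at each t so does at
      least one of \<open>\<eta>1 t\<close>, \<open>\<eta>2 t\<close>.\<close>
    have "omega powi \<epsilon> * (\<eta>1 t * \<mu> (t + 1/3)) = omega powi \<epsilon> * (\<eta>1 t * \<mu> t)"
      "omega powi (\<epsilon> * 2) * (\<eta>2 t * \<mu> (t + 1/3)) = omega powi (\<epsilon> * 2) * (\<eta>2 t * \<mu> t)"
      using \<theta>1[of "t + 1/3"] \<theta>2[of "t + 1/3"] \<theta>1[of t] \<theta>2[of t] \<eta> \<theta>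
      unfolding equivariant_quotient_def by (metis mult.assoc)+
    then show ?thesis
      using \<eta>_nz[of t] by auto
  qed
qed

text \<open>The last conjunct is an equivalence: the displayed formula yields every orbit of shape
  \<gamma> and nothing else. By \<open>base\<close>, \<open>the (\<gamma> 0)\<close> is a genuine
  nonzero number.\<close>

theorem proposition6p4:
  fixes \<epsilon> :: int and \<gamma> \<xi> :: "real \<Rightarrow> P1"
  assumes eps: "\<epsilon> \<in> {1, -1}"
    and cont: "continuous_map euclideanreal P1_topology \<gamma>"
    and avoid: "\<And>t. \<gamma> t \<notin> {P1_of 1, P1_of omega, P1_of (omega\<^sup>2)}"
    and nonconst: "\<not> \<gamma> constant_on UNIV"
    and base: "\<gamma> 0 \<notin> {P1_of 0, P1_infty}"
    and twist: "\<And>t. \<gamma> (t + 1/3) = P1_scale (omega powi \<epsilon>) (\<gamma> t)"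
    and xi: "\<And>t. \<xi> t = P1_scale (1 / the (\<gamma> 0)) (\<gamma> t)"
  shows
    "((\<exists>D. single_tracing_orbit \<epsilon> D \<and> collision_free D \<and> (\<forall>t. psi (D t) = \<gamma> t))
        \<longleftrightarrow> (\<exists>\<eta>1 \<eta>2. equivariant_quotient \<epsilon> \<xi> \<eta>1 \<eta>2))
     \<and>
     ((\<forall>t. \<gamma> t \<noteq> P1_infty) \<longrightarrow>
        equivariant_quotient \<epsilon> \<xi>
          (\<lambda>t. exp (2 * of_real pi * \<i> * of_int \<epsilon> * of_real t))
          (\<lambda>t. exp (2 * of_real pi * \<i> * of_int \<epsilon> * of_real t) * the (\<xi> t)))
     \<and>
     (\<forall>\<eta>1 \<eta>2. equivariant_quotient \<epsilon> \<xi> \<eta>1 \<eta>2 \<longrightarrow>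
        (\<forall>D. single_tracing_orbit \<epsilon> D \<and> (\<forall>t. psi (D t) = \<gamma> t) \<longleftrightarrow>
          (\<exists>\<mu> D0. continuous_on UNIV \<mu> \<and> (\<forall>t. \<mu> t \<noteq> 0) \<and> (\<forall>t. \<mu> (t + 1/3) = \<mu> t) \<and>
             D0 \<in> nondegenerate \<and> psi D0 = \<gamma> 0 \<and>
             (\<forall>t. D t = (W_mat ** diag3 1 (\<eta>1 t * \<mu> t) (\<eta>2 t * \<mu> t) ** matrix_inv W_mat) *v D0))))"
proof (intro conjI allI impI)
  obtain c where c: "\<gamma> 0 = P1_of c" "c \<noteq> 0"
    using base by (cases "\<gamma> 0") auto
  have scale: "P1_scale c (\<xi> t) = \<gamma> t" for t
    using xi[of t] c P1_scale_eq_iff[of c "\<xi> t" "\<gamma> t"] by simp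
  have quot_of_orbit: "equivariant_quotient \<epsilon> \<xi> (\<lambda>t. psi1 (D t) / psi1 (D 0)) (\<lambda>t. psi2 (D t) / psi2 (D 0))"
    if "single_tracing_orbit \<epsilon> D" "\<And>t. psi (D t) = \<gamma> t" for D
    using equivariant_quotient_of_orbit[OF eps that(1)] base
    by (simp add: that(2) xi[symmetric])
  have orbit_of_quot: "single_tracing_orbit \<epsilon> (\<lambda>t. S_op (\<eta>2 t) (\<eta>1 t) *v D0)"
    "\<And>t. psi (S_op (\<eta>2 t) (\<eta>1 t) *v D0) = \<gamma> t"
    if "equivariant_quotient \<epsilon> \<xi> \<eta>1 \<eta>2" "psi D0 = \<gamma> 0" for \<eta>1 \<eta>2 D0
    using orbit_of_equivariant_quotient[OF eps that(1), of D0] base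
    by (simp_all add: that(2) c(1) scale)

  show "(\<exists>D. single_tracing_orbit \<epsilon> D \<and> collision_free D \<and> (\<forall>t. psi (D t) = \<gamma> t))
        \<longleftrightarrow> (\<exists>\<eta>1 \<eta>2. equivariant_quotient \<epsilon> \<xi> \<eta>1 \<eta>2)"
  proof
    assume "\<exists>D. single_tracing_orbit \<epsilon> D \<and> collision_free D \<and> (\<forall>t. psi (D t) = \<gamma> t)"
    then show "\<exists>\<eta>1 \<eta>2. equivariant_quotient \<epsilon> \<xi> \<eta>1 \<eta>2"
      using quot_of_orbit by blast
  next
    assume "\<exists>\<eta>1 \<eta>2. equivariant_quotient \<epsilon> \<xi> \<eta>1 \<eta>2"
    then obtain \<eta>1 \<eta>2 where \<eta>: "equivariant_quotient \<epsilon> \<xi> \<eta>1 \<eta>2" by blast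
    \<comment> \<open>The base triple has centroid 0 and coordinates \<open>psi1\<close> = 1,
      \<open>psi2\<close> = c, hence shape c.\<close>
    define D where "D t = S_op (\<eta>2 t) (\<eta>1 t) *v (W_mat *v vector [0, 1, c])" for t
    have "psi (W_mat *v vector [0, 1, c]) = \<gamma> 0"
      by (simp add: psi_def P1_quot_def c(1))
    then have D: "single_tracing_orbit \<epsilon> D" "\<And>t. psi (D t) = \<gamma> t"
      unfolding D_def using orbit_of_quot[OF \<eta>] by blast+
    moreover have "collision_free D"
      using D avoid by (intro collision_free_if_shape)
        (auto simp: single_tracing_orbit_def dest: triangle_familyD(1))
    ultimately show "\<exists>D. single_tracing_orbit \<epsilon> D \<and> collision_free D \<and> (\<forall>t. psi (D t) = \<gamma> t)"
      by blast
  qed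

  show "equivariant_quotient \<epsilon> \<xi>
      (\<lambda>t. exp (2 * of_real pi * \<i> * of_int \<epsilon> * of_real t))
      (\<lambda>t. exp (2 * of_real pi * \<i> * of_int \<epsilon> * of_real t) * the (\<xi> t))"
    if "\<forall>t. \<gamma> t \<noteq> P1_infty"
  proof -
    have fin: "\<gamma> t = P1_of (the (\<gamma> t))" for t
      using that by simp
    have \<xi>: "\<xi> t = P1_of (the (\<gamma> t) / c)" for t
      using xi[of t] fin[of t] c(1) by (metis P1_scale_def option.map(2) option.sel times_divide_eq_left mult_1)
    have shift: "the (\<gamma> (t + 1/3)) = omega powi \<epsilon> * the (\<gamma> t)" for t
      using twist[of t] fin[of t] by (metis P1_scale_def option.map(2) option.sel)
    \<comment> \<open>In the multiplier of the numerator one factor comes from the exponential, the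
      other from \<open>twist\<close>.\<close>
    have "omega powi (\<epsilon> * 2) = omega powi \<epsilon> * omega powi \<epsilon>"
      using power_int_add[of omega \<epsilon> \<epsilon>] by (simp add: mult_2_right)
    moreover have "continuous_on UNIV (\<lambda>t. the (\<gamma> t))"
      using continuous_on_the_P1[OF cont] that by blast
    ultimately show ?thesis
      using c(2) unfolding equivariant_quotient_def exp_third_eq_omega_powi
      by (auto simp: \<xi> shift P1_quot_def intro!: continuous_intros)
  qed

  fix \<eta>1 \<eta>2 D
  assume \<eta>: "equivariant_quotient \<epsilon> \<xi> \<eta>1 \<eta>2"
  show "single_tracing_orbit \<epsilon> D \<and> (\<forall>t. psi (D t) = \<gamma> t) \<longleftrightarrow>
      (\<exists>\<mu> D0. continuous_on UNIV \<mu> \<and> (\<forall>t. \<mu> t \<noteq> 0) \<and> (\<forall>t. \<mu> (t + 1/3) = \<mu> t) \<and>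
         D0 \<in> nondegenerate \<and> psi D0 = \<gamma> 0 \<and>
         (\<forall>t. D t = (W_mat ** diag3 1 (\<eta>1 t * \<mu> t) (\<eta>2 t * \<mu> t) ** matrix_inv W_mat) *v D0))"
    \<comment> \<open>Folding the displayed product into \<open>S_op\<close> makes the coordinate
      rules applicable.\<close>
    unfolding S_op_def[symmetric]
  proof
    assume "single_tracing_orbit \<epsilon> D \<and> (\<forall>t. psi (D t) = \<gamma> t)"
    then have D: "single_tracing_orbit \<epsilon> D" "\<And>t. psi (D t) = \<gamma> t" by auto
    then have fam: "triangle_family D"
      by (simp add: single_tracing_orbit_def)
    \<comment> \<open>The normalised coordinates of D are a second lift of \<xi>, to be compared
      with the given one.\<close>
    obtain \<mu> where \<mu>: "continuous_on UNIV \<mu>" "\<And>t. \<mu> t \<noteq> 0" "\<And>t. \<mu> (t + 1/3) = \<mu> t"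
      "\<And>t. psi1 (D t) / psi1 (D 0) = \<eta>1 t * \<mu> t" "\<And>t. psi2 (D t) / psi2 (D 0) = \<eta>2 t * \<mu> t"
      using equivariant_quotient_unique[OF \<eta> quot_of_orbit[OF D]] by blast
    have nz: "psi1 (D 0) \<noteq> 0" "psi2 (D 0) \<noteq> 0"
      using psi_nonzero_if[of "D 0"] base D(2) by auto
    \<comment> \<open>The base triple is \<open>D 0\<close> itself; the centroids agree because
      \<open>psi0\<close> is constant along the family.\<close>
    have "D t = S_op (\<eta>2 t * \<mu> t) (\<eta>1 t * \<mu> t) *v D 0" for t
      using nz triangle_familyD(2)[OF fam]
      by (subst eq_iff_psi_eq) (simp add: \<mu>(4,5)[symmetric])
    then show "\<exists>\<mu> D0. continuous_on UNIV \<mu> \<and> (\<forall>t. \<mu> t \<noteq> 0) \<and> (\<forall>t. \<mu> (t + 1/3) = \<mu> t) \<and>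
         D0 \<in> nondegenerate \<and> psi D0 = \<gamma> 0 \<and>
         (\<forall>t. D t = S_op (\<eta>2 t * \<mu> t) (\<eta>1 t * \<mu> t) *v D0)"
      using \<mu>(1-3) triangle_familyD(1)[OF fam] D(2) by blast
  next
    assume "\<exists>\<mu> D0. continuous_on UNIV \<mu> \<and> (\<forall>t. \<mu> t \<noteq> 0) \<and> (\<forall>t. \<mu> (t + 1/3) = \<mu> t) \<and>
         D0 \<in> nondegenerate \<and> psi D0 = \<gamma> 0 \<and>
         (\<forall>t. D t = S_op (\<eta>2 t * \<mu> t) (\<eta>1 t * \<mu> t) *v D0)"
    then obtain \<mu> D0 where \<mu>: "continuous_on UNIV \<mu>" "\<And>t. \<mu> t \<noteq> 0" "\<And>t. \<mu> (t + 1/3) = \<mu> t"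
      and D0: "psi D0 = \<gamma> 0" and D_eq: "\<forall>t. D t = S_op (\<eta>2 t * \<mu> t) (\<eta>1 t * \<mu> t) *v D0"
      by blast
    have D: "D = (\<lambda>t. S_op (\<eta>2 t * \<mu> t) (\<eta>1 t * \<mu> t) *v D0)"
      using D_eq by auto
    show "single_tracing_orbit \<epsilon> D \<and> (\<forall>t. psi (D t) = \<gamma> t)"
      unfolding D using orbit_of_quot[OF equivariant_quotient_scale[OF \<eta> \<mu>] D0] by blast
  qed
qed

end
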